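(* Mirkin Distance Minimization can be solved in $2^{O(m^2\cdot 2^{m^2})}\cdot n^2$ time, where $m$ is the number of input strings and $n$ their length.
   Context: For binary strings $s, s' \in \{0,1\}^n$, the Mirkin distance is $\mathsf{mirk}(s,s') = d_H(s,s')\cdot(n - d_H(s,s'))$, where $d_H$ is the Hamming distance. Mirkin Distance Minimization: given binary strings $s_1, \ldots, s_m \in \{0,1\}^n$ and an integer $k$, decide whether there is a string $s^* \in \{0,1\}^n$ with $\sum_{i=1}^m \mathsf{mirk}(s^*, s_i) \le k$. *)

theory Defs
  imports Complex_Main "HOL-Library.Landau_Symbols"
begin

text \<open>
  Running time is measured on the random access machine of Cook and Reckhow (Time bounded random
  access machines, JCSS 7, 1973) under the uniform cost criterion: one step per executed
  instruction. Registers hold integers; addition and subtraction are the only arithmetic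
  operations, so unit cost is reasonable in that the machine is polynomially equivalent to
  Turing machines.
\<close>

datatype instr =
    Const nat int      \<comment> \<open>\<open>X\<^sub>i \<leftarrow> C\<close>\<close>
  | Add nat nat nat    \<comment> \<open>\<open>X\<^sub>i \<leftarrow> X\<^sub>j + X\<^sub>k\<close>\<close>
  | Sub nat nat nat    \<comment> \<open>\<open>X\<^sub>i \<leftarrow> X\<^sub>j - X\<^sub>k\<close>\<close>
  | Load nat nat       \<comment> \<open>\<open>X\<^sub>i \<leftarrow> X\<^bsub>X\<^sub>j\<^esub>\<close>\<close>
  | Store nat nat      \<comment> \<open>\<open>X\<^bsub>X\<^sub>i\<^esub> \<leftarrow> X\<^sub>j\<close>\<close>
  | Jump nat nat       \<comment> \<open>continue at instruction \<open>l\<close> if \<open>X\<^sub>j > 0\<close>\<close>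
  | Read nat           \<comment> \<open>\<open>X\<^sub>i \<leftarrow>\<close> next integer of the input\<close>
  | Print nat          \<comment> \<open>append \<open>X\<^sub>i\<close> to the output\<close>

type_synonym program = "instr list"

record config =
  pc :: nat
  regs :: "nat \<Rightarrow> int"
  inp :: "int list"
  outp :: "int list"

definition init :: "int list \<Rightarrow> config" where
  "init xs = \<lparr>pc = 0, regs = (\<lambda>_. 0), inp = xs, outp = []\<rparr>"

text \<open>The result \<open>None\<close> is given for accesses to negative addresses and reads past the end of the
  input.\<close>

fun exec_instr :: "instr \<Rightarrow> config \<Rightarrow> config option" where
  "exec_instr (Const i c) s = Some (s\<lparr>pc := Suc (pc s), regs := (regs s)(i := c)\<rparr>)"
| "exec_instr (Add i j k) s =
     Some (s\<lparr>pc := Suc (pc s), regs := (regs s)(i := regs s j + regs s k)\<rparr>)"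
| "exec_instr (Sub i j k) s =
     Some (s\<lparr>pc := Suc (pc s), regs := (regs s)(i := regs s j - regs s k)\<rparr>)"
| "exec_instr (Load i j) s =
     (if regs s j < 0 then None
      else Some (s\<lparr>pc := Suc (pc s), regs := (regs s)(i := regs s (nat (regs s j)))\<rparr>))"
| "exec_instr (Store i j) s =
     (if regs s i < 0 then None
      else Some (s\<lparr>pc := Suc (pc s), regs := (regs s)(nat (regs s i) := regs s j)\<rparr>))"
| "exec_instr (Jump l j) s = Some (s\<lparr>pc := (if regs s j > 0 then l else Suc (pc s))\<rparr>)"
| "exec_instr (Read i) s =
     (case inp s of [] \<Rightarrow> None
      | x # xs \<Rightarrow> Some (s\<lparr>pc := Suc (pc s), regs := (regs s)(i := x), inp := xs\<rparr>))"
| "exec_instr (Print i) s = Some (s\<lparr>pc := Suc (pc s), outp := outp s @ [regs s i]\<rparr>)"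

definition step :: "program \<Rightarrow> config \<Rightarrow> config \<Rightarrow> bool" where
  "step P s s' \<longleftrightarrow> pc s < length P \<and> exec_instr (P ! pc s) s = Some s'"

text \<open>On input \<open>xs\<close>, the program halts after exactly \<open>t\<close> steps by running past its last instruction,
  having printed \<open>ys\<close>.\<close>

definition computes_in :: "program \<Rightarrow> int list \<Rightarrow> nat \<Rightarrow> int list \<Rightarrow> bool" where
  "computes_in P xs t ys \<longleftrightarrow>
     (\<exists>s. (step P ^^ t) (init xs) s \<and> pc s \<ge> length P \<and> outp s = ys)"

definition decides_in_time ::
  "program \<Rightarrow> 'a set \<Rightarrow> ('a \<Rightarrow> int list) \<Rightarrow> ('a \<Rightarrow> bool) \<Rightarrow> ('a \<Rightarrow> real) \<Rightarrow> bool" where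
  "decides_in_time P Inst enc yes T \<longleftrightarrow>
     (\<forall>x\<in>Inst. \<exists>t. computes_in P (enc x) t [if yes x then 1 else 0] \<and> real t \<le> T x)"

definition hamming :: "bool list \<Rightarrow> bool list \<Rightarrow> nat" where
  "hamming s s' = card {i. i < length s \<and> s ! i \<noteq> s' ! i}"

definition mirk :: "bool list \<Rightarrow> bool list \<Rightarrow> nat" where
  "mirk s s' = hamming s s' * (length s - hamming s s')"

text \<open>An instance is a triple of the common length \<open>n\<close>, the strings and the bound \<open>k\<close>. Strings have
  positive length, since a running time of the form \<open>f m * n\<^sup>2\<close> would vanish for \<open>n = 0\<close>.\<close>

type_synonym mdm_instance = "nat \<times> bool list list \<times> int"

definition mdm_instances :: "mdm_instance set" where
  "mdm_instances = {(n, ss, k). n \<ge> 1 \<and> (\<forall>s\<in>set ss. length s = n)}"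

definition mdm_yes :: "mdm_instance \<Rightarrow> bool" where
  "mdm_yes = (\<lambda>(n, ss, k).
     \<exists>s. length s = n \<and> int (\<Sum>i<length ss. mirk s (ss ! i)) \<le> k)"

definition mdm_encode :: "mdm_instance \<Rightarrow> int list" where
  "mdm_encode = (\<lambda>(n, ss, k).
     [int (length ss), int n, k] @ concat (map (map of_bool) ss))"

end

theory Submission
  imports Defs
begin

text \<open>
  The objective is a sum of terms \<open>h (n - h)\<close>, each strictly concave in the Hamming distance \<open>h\<close>. If an
  optimal string had different values at two positions where the input columns agree, then the two
  strings obtained by changing either value would have objectives averaging strictly below the
  optimum. So for \<open>m \<ge> 1\<close> an optimal string is a Boolean function of the input column, and it suffices
  to try all \<open>2 ^ 2 ^ m\<close> such functions. The program encodes columns as numbers below \<open>2 ^ m\<close>, runs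
  through the functions with a binary counter of \<open>2 ^ m\<close> bits, and multiplies by repeated addition,
  which takes time linear in \<open>n\<close> for each function.
\<close>

section \<open>A structured language compiled to the random access machine\<close>

datatype var = Vm | Vn | Vk | Vone | Vzero | Vw | Vp | Vi | Vj | Vr | Vx | Vy | Vd | Ve
  | Vacc | Vres | Vgo

datatype arr = Str | Col | Tab

datatype com =
    Set var int
  | Plus var var var
  | Minus var var var
  | Get var arr var
  | Put arr var var
  | Input var
  | Output var
  | Seq com com (infixr ";;" 60)
  | Branch var com com
  | While var com

record state =
  vars :: "var \<Rightarrow> int"
  arrs :: "arr \<Rightarrow> nat \<Rightarrow> int"
  ins :: "int list"
  outs :: "int list"
  clock :: nat

abbreviation tick :: "nat \<Rightarrow> state \<Rightarrow> state" where
  "tick t s \<equiv> s\<lparr>clock := clock s + t\<rparr>"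

text \<open>The clock advances by the exact number of machine steps of the compiled code.\<close>

inductive exec :: "com \<Rightarrow> state \<Rightarrow> state \<Rightarrow> bool" where
  Set: "exec (Set x c) s (s\<lparr>vars := (vars s)(x := c), clock := clock s + 1\<rparr>)"
| Plus: "exec (Plus x y z) s (s\<lparr>vars := (vars s)(x := vars s y + vars s z), clock := clock s + 1\<rparr>)"
| Minus: "exec (Minus x y z) s (s\<lparr>vars := (vars s)(x := vars s y - vars s z), clock := clock s + 1\<rparr>)"
| Get: "vars s y \<ge> 0 \<Longrightarrow>
    exec (Get x a y) s (s\<lparr>vars := (vars s)(x := arrs s a (nat (vars s y))), clock := clock s + 6\<rparr>)"
| Put: "vars s x \<ge> 0 \<Longrightarrow>
    exec (Put a x y) s
      (s\<lparr>arrs := (arrs s)(a := (arrs s a)(nat (vars s x) := vars s y)), clock := clock s + 6\<rparr>)"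
| Input: "ins s = v # vs \<Longrightarrow>
    exec (Input x) s (s\<lparr>vars := (vars s)(x := v), ins := vs, clock := clock s + 1\<rparr>)"
| Output: "exec (Output x) s (s\<lparr>outs := outs s @ [vars s x], clock := clock s + 1\<rparr>)"
| Seq: "exec c s s' \<Longrightarrow> exec d s' s'' \<Longrightarrow> exec (c ;; d) s s''"
| Branch_pos: "vars s x > 0 \<Longrightarrow> exec c (tick 1 s) s' \<Longrightarrow> exec (Branch x c d) s s'"
| Branch_nonpos: "\<not> vars s x > 0 \<Longrightarrow> exec d (tick 1 s) s' \<Longrightarrow> exec (Branch x c d) s (tick 2 s')"
| While_pos: "vars s x > 0 \<Longrightarrow> exec c (tick 1 s) s' \<Longrightarrow> exec (While x c) (tick 2 s') s'' \<Longrightarrow>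
    exec (While x c) s s''"
| While_nonpos: "\<not> vars s x > 0 \<Longrightarrow> exec (While x c) s (tick 3 s)"

text \<open>Register 0 is scratch. The other multiples of 4 hold the variables, and the residue classes
  1, 2, 3 modulo 4 hold the three unbounded arrays.\<close>

primrec reg :: "var \<Rightarrow> nat" where
  "reg Vm = 4" | "reg Vn = 8" | "reg Vk = 12" | "reg Vone = 16" | "reg Vzero = 20" | "reg Vw = 24"
| "reg Vp = 28" | "reg Vi = 32" | "reg Vj = 36" | "reg Vr = 40" | "reg Vx = 44" | "reg Vy = 48"
| "reg Vd = 52" | "reg Ve = 56" | "reg Vacc = 60" | "reg Vres = 64" | "reg Vgo = 68"

primrec offs :: "arr \<Rightarrow> nat" where
  "offs Str = 1" | "offs Col = 2" | "offs Tab = 3"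

lemma reg_inject [simp]: "reg x = reg y \<longleftrightarrow> x = y"
  by (cases x; cases y; simp)

lemma offs_inject [simp]: "offs a = offs b \<longleftrightarrow> a = b"
  by (cases a; cases b; simp)

lemma reg_neq_0 [simp]: "reg x \<noteq> 0"
  by (cases x; simp)

lemma reg_mod_4: "reg x mod 4 = 0"
  by (cases x; simp)

lemma offs_neq_0 [simp]: "offs a \<noteq> 0"
  by (cases a; simp)

lemma offs_less_4: "offs a < 4"
  by (cases a; simp)

lemma offs_mod_4 [simp]: "(4 * i + offs a) mod 4 = offs a"
  using offs_less_4 by simp

text \<open>Residues modulo 4 keep variables and array cells apart, so a write to one never disturbs
  another.\<close>

lemma array_cell_neq_reg [simp]: "4 * i + offs a \<noteq> reg x" "reg x \<noteq> 4 * i + offs a"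
  using offs_mod_4[of i a] reg_mod_4[of x] offs_neq_0[of a] by metis+

lemma array_cell_inject [simp]: "4 * i + offs a = 4 * j + offs b \<longleftrightarrow> i = j \<and> a = b"
proof
  assume *: "4 * i + offs a = 4 * j + offs b"
  then have "offs a = offs b"
    using offs_mod_4 by metis
  then show "i = j \<and> a = b"
    using * by simp
qed simp

text \<open>Jump targets are absolute, so block lengths must be known before code is emitted. The 3
  of \<open>Branch\<close> is one test and one unconditional jump, which takes two instructions; the
  5 of \<open>While\<close> is one test and two such jumps.\<close>

fun code_size :: "com \<Rightarrow> nat" where
  "code_size (Get _ _ _) = 6"
| "code_size (Put _ _ _) = 6"
| "code_size (c ;; d) = code_size c + code_size d"
| "code_size (Branch _ c d) = code_size c + code_size d + 3"
| "code_size (While _ c) = code_size c + 5"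
| "code_size _ = 1"

text \<open>There is no multiplication, so register 0 receives the offset and then the index four
  times. These five instructions and the access itself make up the 6 ticks of \<open>Get\<close> and
  \<open>Put\<close>.\<close>

definition cell_address :: "arr \<Rightarrow> var \<Rightarrow> instr list" where
  "cell_address a x = Const 0 (int (offs a)) # replicate 4 (Add 0 0 (reg x))"

text \<open>The first argument is the address at which the code is placed.\<close>

fun compile :: "nat \<Rightarrow> com \<Rightarrow> instr list" where
  "compile p (Set x c) = [Const (reg x) c]"
| "compile p (Plus x y z) = [Add (reg x) (reg y) (reg z)]"
| "compile p (Minus x y z) = [Sub (reg x) (reg y) (reg z)]"
| "compile p (Get x a y) = cell_address a y @ [Load (reg x) 0]"
| "compile p (Put a x y) = cell_address a x @ [Store 0 (reg y)]"
| "compile p (Input x) = [Read (reg x)]"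
| "compile p (Output x) = [Print (reg x)]"
| "compile p (c ;; d) = compile p c @ compile (p + code_size c) d"
| "compile p (Branch x c d) =
     Jump (p + code_size d + 3) (reg x) # compile (p + 1) d @
     [Const 0 1, Jump (p + code_size d + 3 + code_size c) 0] @ compile (p + code_size d + 3) c"
| "compile p (While x c) =
     [Jump (p + 3) (reg x), Const 0 1, Jump (p + code_size c + 5) 0] @ compile (p + 3) c @
     [Const 0 1, Jump p 0]"

lemma length_compile [simp]: "length (compile p c) = code_size c"
  by (induction p c rule: compile.induct) (auto simp: cell_address_def)

section \<open>Simulation of the language by machine steps\<close>

definition code_at :: "program \<Rightarrow> nat \<Rightarrow> instr list \<Rightarrow> bool" where
  "code_at P p is \<longleftrightarrow> (\<forall>k<length is. p + k < length P \<and> P ! (p + k) = is ! k)"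

lemma code_at_Nil [simp]: "code_at P p []"
  by (simp add: code_at_def)

lemma code_at_Cons [simp]:
  "code_at P p (i # is) \<longleftrightarrow> p < length P \<and> P ! p = i \<and> code_at P (Suc p) is"
  unfolding code_at_def by (auto simp: All_less_Suc2)

lemma code_at_append [simp]:
  "code_at P p (xs @ ys) \<longleftrightarrow> code_at P p xs \<and> code_at P (p + length xs) ys"
  by (induction xs arbitrary: p) auto

text \<open>Register 0 is left free, since address computations and unconditional jumps overwrite
  it. The program counter and the clock are tracked separately.\<close>

definition represents :: "state \<Rightarrow> config \<Rightarrow> bool" where
  "represents s c \<longleftrightarrow>
     (\<forall>x. regs c (reg x) = vars s x) \<and> (\<forall>a i. regs c (4 * i + offs a) = arrs s a i) \<and>
     inp c = ins s \<and> outp c = outs s"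

lemma represents_tick [simp]: "represents (tick t s) c \<longleftrightarrow> represents s c"
  by (simp add: represents_def)

lemma steps_cell_address:
  assumes "code_at P (pc c) (cell_address a x)" "represents s c"
  shows "(step P ^^ 5) c
    (c\<lparr>pc := pc c + 5, regs := (regs c)(0 := int (offs a) + 4 * vars s x)\<rparr>)"
proof -
  have [simp]: "regs c (reg x) = vars s x"
    using assms(2) by (simp add: represents_def)
  show ?thesis
    using assms(1)
    by (auto simp: cell_address_def numeral_eq_Suc step_def relcompp_apply add.commute)
qed

lemmas step_steps = relpowp_Suc_I2[of "step P" for P]
lemmas steps_step = relpowp_Suc_I[of _ "step P" for P]
lemmas steps_trans = relpowp_trans[of _ "step P" for P]

text \<open>Induction on the execution instead of the command, because a loop recurs in its own
  premise. The last conjunct lets all later time bounds be proved on the clock alone.\<close>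

theorem compile_correct:
  assumes "exec cm s s'" "code_at P p (compile p cm)" "represents s c" "pc c = p"
  shows "\<exists>t c'. (step P ^^ t) c c' \<and> represents s' c' \<and> pc c' = p + code_size cm \<and>
    clock s' = clock s + t"
  using assms
proof (induction arbitrary: p c rule: exec.induct)
  case (Set x v s)
  then show ?case
    by (intro exI[of _ 1] exI[of _ "c\<lparr>pc := Suc p, regs := (regs c)(reg x := v)\<rparr>"])
       (auto simp: step_def represents_def)
next
  case (Plus x y z s)
  then show ?case
    by (intro exI[of _ 1]
        exI[of _ "c\<lparr>pc := Suc p, regs := (regs c)(reg x := vars s y + vars s z)\<rparr>"])
       (auto simp: step_def represents_def)
next
  case (Minus x y z s)
  then show ?case
    by (intro exI[of _ 1]
        exI[of _ "c\<lparr>pc := Suc p, regs := (regs c)(reg x := vars s y - vars s z)\<rparr>"])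
       (auto simp: step_def represents_def)
next
  case (Get s y x a)
  let ?v = "int (offs a) + 4 * vars s y"
  let ?c1 = "c\<lparr>pc := p + 5, regs := (regs c)(0 := ?v)\<rparr>"
  let ?c2 = "?c1\<lparr>pc := p + 6, regs := (regs ?c1)(reg x := arrs s a (nat (vars s y)))\<rparr>"
  \<comment> \<open>The index is nonnegative by the rule for \<open>Get\<close>, so the integer in
    register 0 is the address of an array cell and the \<open>Load\<close> succeeds.\<close>
  have v: "nat ?v = 4 * nat (vars s y) + offs a"
    using Get.hyps by (simp add: nat_add_distrib nat_mult_distrib)
  have "(step P ^^ 5) c ?c1"
    using steps_cell_address[of P c a y s] Get.prems by simp
  moreover have "5 + p < length P" "P ! (5 + p) = Load (reg x) 0"
    using Get.prems by (auto simp: cell_address_def)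
  then have "step P ?c1 ?c2"
    using Get.prems Get.hyps v by (simp add: step_def represents_def add.commute)
  ultimately have "(step P ^^ Suc 5) c ?c2"
    by (rule steps_step)
  moreover have "represents (s\<lparr>vars := (vars s)(x := arrs s a (nat (vars s y))),
      clock := clock s + 6\<rparr>) ?c2"
    using Get.prems by (auto simp: represents_def)
  ultimately show ?case
    by (intro exI[of _ "Suc 5"] exI[of _ ?c2]) simp
next
  case (Put s x a y)
  let ?v = "int (offs a) + 4 * vars s x"
  let ?c1 = "c\<lparr>pc := p + 5, regs := (regs c)(0 := ?v)\<rparr>"
  let ?c2 = "?c1\<lparr>pc := p + 6, regs := (regs ?c1)(nat ?v := vars s y)\<rparr>"
  have v: "nat ?v = 4 * nat (vars s x) + offs a"
    using Put.hyps by (simp add: nat_add_distrib nat_mult_distrib)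
  have "(step P ^^ 5) c ?c1"
    using steps_cell_address[of P c a x s] Put.prems by simp
  moreover have "5 + p < length P" "P ! (5 + p) = Store 0 (reg y)"
    using Put.prems by (auto simp: cell_address_def)
  then have "step P ?c1 ?c2"
    using Put.prems Put.hyps by (simp add: step_def represents_def add.commute)
  ultimately have "(step P ^^ Suc 5) c ?c2"
    by (rule steps_step)
  moreover have "represents (s\<lparr>arrs := (arrs s)(a := (arrs s a)(nat (vars s x) := vars s y)),
      clock := clock s + 6\<rparr>) ?c2"
    using Put.prems unfolding v by (auto simp: represents_def)
  ultimately show ?case
    by (intro exI[of _ "Suc 5"] exI[of _ ?c2]) simp
next
  case (Input s v vs x)
  then show ?case
    by (intro exI[of _ 1] exI[of _ "c\<lparr>pc := Suc p, regs := (regs c)(reg x := v), inp := vs\<rparr>"])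
       (auto simp: step_def represents_def)
next
  case (Output x s)
  then show ?case
    by (intro exI[of _ 1] exI[of _ "c\<lparr>pc := Suc p, outp := outp c @ [vars s x]\<rparr>"])
       (auto simp: step_def represents_def)
next
  case (Seq cm s s' dm s'')
  obtain t c' where 1: "(step P ^^ t) c c'" "represents s' c'" "pc c' = p + code_size cm"
    "clock s' = clock s + t"
    using Seq.IH(1)[of p c] Seq.prems by auto
  obtain t' c'' where 2: "(step P ^^ t') c' c''" "represents s'' c''"
    "pc c'' = p + code_size cm + code_size dm" "clock s'' = clock s' + t'"
    using Seq.IH(2)[of "p + code_size cm" c'] Seq.prems 1 by auto
  show ?case
    using 1 2 steps_trans[OF 1(1) 2(1)]
    by (intro exI[of _ "t + t'"] exI[of _ c'']) simp
next
  case (Branch_pos s x cm s' dm)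
  let ?c0 = "c\<lparr>pc := p + code_size dm + 3\<rparr>"
  have at: "code_at P (p + code_size dm + 3) (compile (p + code_size dm + 3) cm)"
    using Branch_pos.prems by (simp add: numeral_3_eq_3)
  have 0: "step P c ?c0" "represents (tick 1 s) ?c0"
    using Branch_pos.prems Branch_pos.hyps by (auto simp: step_def represents_def)
  obtain t c' where 1: "(step P ^^ t) ?c0 c'" "represents s' c'"
    "pc c' = p + code_size dm + 3 + code_size cm" "clock s' = clock s + 1 + t"
    using Branch_pos.IH[of "p + code_size dm + 3" ?c0] at 0 by auto
  show ?case
    by (intro exI conjI, rule step_steps[OF 0(1) 1(1)], rule 1(2))
       (use 1(3,4) in simp_all)
next
  case (Branch_nonpos s x dm s' cm)
  let ?c0 = "c\<lparr>pc := Suc p\<rparr>"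
  have 0: "step P c ?c0" "represents (tick 1 s) ?c0"
    using Branch_nonpos.prems Branch_nonpos.hyps by (auto simp: step_def represents_def)
  obtain t c' where 1: "(step P ^^ t) ?c0 c'" "represents s' c'"
    "pc c' = Suc p + code_size dm" "clock s' = clock s + 1 + t"
    using Branch_nonpos.IH[of "Suc p" ?c0] Branch_nonpos.prems(1) 0(2) by auto
  \<comment> \<open>The machine has only conditional jumps: a 1 in register 0 forces the next one.
    These two steps are the \<open>tick 2\<close> after the branch.\<close>
  let ?c1 = "c'\<lparr>pc := p + code_size dm + 2, regs := (regs c')(0 := 1)\<rparr>"
  let ?c2 = "?c1\<lparr>pc := p + code_size dm + 3 + code_size cm\<rparr>"
  have 2: "step P c' ?c1" "step P ?c1 ?c2"
    using Branch_nonpos.prems(1) 1(3) by (simp_all add: step_def)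
  have 3: "represents (tick 2 s') ?c2"
    using 1(2) by (simp add: represents_def)
  show ?case
    by (intro exI conjI, rule steps_step[OF steps_step[OF
            step_steps[OF 0(1) 1(1)] 2(1)] 2(2)], rule 3)
       (use 1(4) in simp_all)
next
  case (While_pos s x cm s' s'')
  let ?c0 = "c\<lparr>pc := p + 3\<rparr>"
  have at: "code_at P (p + 3) (compile (p + 3) cm)"
    using While_pos.prems by (simp add: numeral_3_eq_3)
  have 0: "step P c ?c0" "represents (tick 1 s) ?c0"
    using While_pos.prems While_pos.hyps by (auto simp: step_def represents_def)
  obtain t c' where 1: "(step P ^^ t) ?c0 c'" "represents s' c'"
    "pc c' = p + 3 + code_size cm" "clock s' = clock s + 1 + t"
    using While_pos.IH(1)[of "p + 3" ?c0] at 0 by auto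
  let ?c1 = "c'\<lparr>pc := p + code_size cm + 4, regs := (regs c')(0 := 1)\<rparr>"
  let ?c2 = "?c1\<lparr>pc := p\<rparr>"
  have 2: "step P c' ?c1" "step P ?c1 ?c2"
    using While_pos.prems(1) 1(3) by (simp_all add: step_def eval_nat_numeral)
  have 3: "represents (tick 2 s') ?c2"
    using 1(2) by (simp add: represents_def)
  \<comment> \<open>Control is back at \<open>p\<close>, in front of the same code, so the second
    hypothesis covers the remaining iterations.\<close>
  obtain t' c'' where 4: "(step P ^^ t') ?c2 c''" "represents s'' c''"
    "pc c'' = p + code_size (While x cm)" "clock s'' = clock s' + 2 + t'"
    using While_pos.IH(2)[of p ?c2] While_pos.prems 3 by auto
  show ?case
    by (intro exI conjI, rule step_steps[OF 0(1) steps_trans[OF 1(1)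
            step_steps[OF 2(1) step_steps[OF 2(2) 4(1)]]]], rule 4(2))
       (use 1(4) 4(3,4) in simp_all)
next
  case (While_nonpos s x cm)
  let ?c1 = "c\<lparr>pc := p + 1\<rparr>"
  let ?c2 = "?c1\<lparr>pc := p + 2, regs := (regs c)(0 := 1)\<rparr>"
  let ?c3 = "?c2\<lparr>pc := p + code_size cm + 5\<rparr>"
  have "step P c ?c1" "step P ?c1 ?c2" "step P ?c2 ?c3"
    using While_nonpos by (auto simp: step_def represents_def)
  then have "(step P ^^ 3) c ?c3"
    by (auto simp: numeral_3_eq_3 relcompp_apply)
  moreover have "represents (tick 3 s) ?c3"
    using While_nonpos by (auto simp: represents_def)
  ultimately show ?case
    by (intro exI[of _ 3] exI[of _ ?c3]) auto
qed

section \<open>Weakest preconditions for total correctness with time\<close>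

definition wp :: "com \<Rightarrow> (state \<Rightarrow> bool) \<Rightarrow> state \<Rightarrow> bool" where
  "wp c Q s \<longleftrightarrow> (\<exists>s'. exec c s s' \<and> Q s')"

\<comment> \<open>\<open>While\<close> is absent because its unfolding reproduces the loop;
  \<open>wp_While\<close> treats it instead.\<close>
inductive_simps exec_iffs:
  "exec (Set x v) s s'"
  "exec (Plus x y z) s s'"
  "exec (Minus x y z) s s'"
  "exec (Get x a y) s s'"
  "exec (Put a x y) s s'"
  "exec (Input x) s s'"
  "exec (Output x) s s'"
  "exec (c ;; d) s s'"
  "exec (Branch x c d) s s'"

lemma wp_simps [simp]:
  "wp (Set x v) Q s \<longleftrightarrow> Q (s\<lparr>vars := (vars s)(x := v), clock := clock s + 1\<rparr>)"
  "wp (Plus x y z) Q s \<longleftrightarrow>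
     Q (s\<lparr>vars := (vars s)(x := vars s y + vars s z), clock := clock s + 1\<rparr>)"
  "wp (Minus x y z) Q s \<longleftrightarrow>
     Q (s\<lparr>vars := (vars s)(x := vars s y - vars s z), clock := clock s + 1\<rparr>)"
  "wp (Get x a y) Q s \<longleftrightarrow> vars s y \<ge> 0 \<and>
     Q (s\<lparr>vars := (vars s)(x := arrs s a (nat (vars s y))), clock := clock s + 6\<rparr>)"
  "wp (Put a x y) Q s \<longleftrightarrow> vars s x \<ge> 0 \<and>
     Q (s\<lparr>arrs := (arrs s)(a := (arrs s a)(nat (vars s x) := vars s y)), clock := clock s + 6\<rparr>)"
  "wp (Input x) Q s \<longleftrightarrow> ins s \<noteq> [] \<and>
     Q (s\<lparr>vars := (vars s)(x := hd (ins s)), ins := tl (ins s), clock := clock s + 1\<rparr>)"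
  "wp (Output x) Q s \<longleftrightarrow> Q (s\<lparr>outs := outs s @ [vars s x], clock := clock s + 1\<rparr>)"
  "wp (c ;; d) Q s \<longleftrightarrow> wp c (wp d Q) s"
  "wp (Branch x c d) Q s \<longleftrightarrow>
     (if vars s x > 0 then wp c Q (tick 1 s) else wp d (\<lambda>s'. Q (tick 2 s')) (tick 1 s))"
  by (auto simp: wp_def exec_iffs neq_Nil_conv)

text \<open>The index \<open>k\<close> counts the iterations still to come, so one induction gives
  termination together with the time bound. The ticks 1, 2 and 3 are a successful test, the jump
  back and the exit.\<close>

lemma wp_While:
  assumes "I k s"
    and "\<And>k s. I (Suc k) s \<Longrightarrow> vars s x > 0 \<and> wp c (\<lambda>s'. I k (tick 2 s')) (tick 1 s)"
    and "\<And>s. I 0 s \<Longrightarrow> \<not> vars s x > 0 \<and> Q (tick 3 s)"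
  shows "wp (While x c) Q s"
  using assms(1)
proof (induction k arbitrary: s)
  case 0
  then show ?case
    using assms(3) unfolding wp_def by (blast intro: exec.While_nonpos)
next
  case (Suc k)
  then obtain s' where "vars s x > 0" "exec c (tick 1 s) s'" "I k (tick 2 s')"
    using assms(2)[OF Suc.prems] unfolding wp_def by blast
  then show ?case
    using Suc.IH[of "tick 2 s'"] unfolding wp_def by (blast intro: exec.While_pos)
qed

text \<open>The all-zero state represents the initial configuration, and code placed at address 0
  finishes at its own length, which is the halting condition.\<close>

theorem wp_computes_in:
  assumes "wp cm (\<lambda>s. outs s = ys \<and> clock s \<le> T)
    \<lparr>vars = (\<lambda>_. 0), arrs = (\<lambda>_ _. 0), ins = xs, outs = [], clock = 0\<rparr>"
  shows "\<exists>t. computes_in (compile 0 cm) xs t ys \<and> t \<le> T"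
proof -
  let ?s = "\<lparr>vars = (\<lambda>_. 0), arrs = (\<lambda>_ _. 0), ins = xs, outs = [], clock = 0\<rparr>"
  obtain s' where s': "exec cm ?s s'" "outs s' = ys" "clock s' \<le> T"
    using assms unfolding wp_def by blast
  have "code_at (compile 0 cm) 0 (compile 0 cm)"
    by (simp add: code_at_def)
  moreover have "represents ?s (init xs)" "pc (init xs) = 0"
    by (simp_all add: represents_def init_def)
  ultimately obtain t c' where "(step (compile 0 cm) ^^ t) (init xs) c'" "represents s' c'"
    "pc c' = code_size cm" "clock s' = t"
    using compile_correct[OF s'(1)] by fastforce
  then show ?thesis
    using s'(2,3) unfolding computes_in_def
    by (intro exI[of _ t] conjI exI[of _ c']) (simp_all add: represents_def)
qed

section \<open>The program\<close>

text \<open>A frame condition: \<open>X\<close> and \<open>Y\<close> list what may be modified. The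
  remaining input and the clock are left free.\<close>

definition unchanged :: "var set \<Rightarrow> arr set \<Rightarrow> state \<Rightarrow> state \<Rightarrow> bool" where
  "unchanged X Y s s' \<longleftrightarrow> (\<forall>x. x \<notin> X \<longrightarrow> vars s' x = vars s x) \<and>
     (\<forall>a. a \<notin> Y \<longrightarrow> arrs s' a = arrs s a) \<and> outs s' = outs s"

section \<open>Objective value of one candidate\<close>

definition add_product :: com where
  "add_product = While Vr (Plus Vacc Vacc Ve ;; Minus Vr Vr Vone)"

text \<open>The sum of \<open>Vacc\<close> and the additions still due is invariant. A round costs
  5: the test, two instructions and the jump back.\<close>

lemma wp_add_product:
  assumes "vars s Vr = int r" "vars s Vone = 1"
    and "\<And>s'. unchanged {Vr, Vacc} {} s s' \<Longrightarrow> vars s' Vacc = vars s Vacc + int r * vars s Ve \<Longrightarrow>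
      clock s' \<le> clock s + 5 * r + 3 \<Longrightarrow> Q s'"
  shows "wp add_product Q s"
  unfolding add_product_def
  by (rule wp_While[where k = r and I = "\<lambda>k s'. unchanged {Vr, Vacc} {} s s' \<and> vars s' Vr = int k \<and>
      vars s' Vacc + int k * vars s Ve = vars s Vacc + int r * vars s Ve \<and>
      clock s' + 5 * k \<le> clock s + 5 * r"])
     (use assms in \<open>auto simp: unchanged_def algebra_simps\<close>)

text \<open>The candidate is never stored: its entry at \<open>Vj\<close> is looked up in the truth
  table \<open>Tab\<close> at the column code \<open>Col\<close> of \<open>Vj\<close>. The branch
  adds \<open>1 - y\<close> or \<open>y\<close>, which for bits is the indicator of \<open>x\<close>
  and \<open>y\<close> being different.\<close>

definition add_hamming :: com where
  "add_hamming = While Vr (Get Vx Str Vp ;; Plus Vp Vp Vone ;; Get Vy Col Vj ;; Get Vy Tab Vy ;;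
     Branch Vx (Plus Vd Vd Vone ;; Minus Vd Vd Vy) (Plus Vd Vd Vy) ;;
     Plus Vj Vj Vone ;; Minus Vr Vr Vone)"

lemma hamming_eq_sum: "int (hamming u t) = (\<Sum>j<length u. of_bool (u ! j \<noteq> t ! j))"
proof -
  have "{j. j < length u \<and> u ! j \<noteq> t ! j} = {j \<in> {..<length u}. u ! j \<noteq> t ! j}"
    by auto
  then show ?thesis
    by (simp add: hamming_def of_bool_def sum.If_cases Int_def)
qed

lemma wp_add_hamming:
  assumes "vars s Vr = int n" "vars s Vone = 1" "vars s Vj = 0" "vars s Vp = int p"
    "length u = n" "vars s Vd = 0"
    "\<And>j. j < n \<Longrightarrow> arrs s Str (p + j) = of_bool (t ! j)"
    "\<And>j. j < n \<Longrightarrow> arrs s Col j \<ge> 0"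
    "\<And>j. j < n \<Longrightarrow> arrs s Tab (nat (arrs s Col j)) = of_bool (u ! j)"
    and "\<And>s'. unchanged {Vx, Vy, Vd, Vp, Vj, Vr} {} s s' \<Longrightarrow> vars s' Vd = int (hamming u t) \<Longrightarrow>
      vars s' Vp = int (p + n) \<Longrightarrow> clock s' \<le> clock s + 28 * n + 3 \<Longrightarrow> Q s'"
  shows "wp add_hamming Q s"
  unfolding add_hamming_def
\<comment> \<open>\<open>n - k\<close> positions have been compared. The rate 28 is the cost of a
  round through the slower branch, taken when \<open>Vx\<close> is 0.\<close>
proof (rule wp_While[where k = n and I = "\<lambda>k s'. unchanged {Vx, Vy, Vd, Vp, Vj, Vr} {} s s' \<and>
      vars s' Vr = int k \<and> k \<le> n \<and> vars s' Vj = int (n - k) \<and> vars s' Vp = int (p + (n - k)) \<and>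
      vars s' Vd = (\<Sum>j<n-k. of_bool (u ! j \<noteq> t ! j)) \<and> clock s' + 28 * k \<le> clock s + 28 * n"],
    goal_cases)
  case 1
  then show ?case
    using assms by (simp add: unchanged_def)
next
  case (2 k s')
  then obtain q where q: "n = q + Suc k"
    by (metis add.commute le_Suc_ex)
  then have [simp]: "n - Suc k = q" "n - k = Suc q"
    by auto
  have "unchanged {Vx, Vy, Vd, Vp, Vj, Vr} {} s s'" "vars s' Vr = 1 + int k" "vars s' Vj = int q"
    "vars s' Vp = int p + int q" "vars s' Vd = (\<Sum>j<q. of_bool (u ! j \<noteq> t ! j))"
    "clock s' + 28 * Suc k \<le> clock s + 28 * n"
    using 2 by simp_all
  moreover have "arrs s Str (p + q) = of_bool (t ! q)" "arrs s Col q \<ge> 0"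
    "arrs s Tab (nat (arrs s Col q)) = of_bool (u ! q)"
    using assms(7-9) q by simp_all
  ultimately show ?case
    using q assms(2) by (cases "u ! q"; cases "t ! q"; simp add: unchanged_def nat_int_add del: sum_of_bool_eq)
next
  case (3 s')
  then show ?case
    using assms(10)[of "tick 3 s'"] assms(5) by (simp add: unchanged_def hamming_eq_sum)
qed

lemma hamming_le_length: "hamming u t \<le> length u"
  unfolding hamming_def by (rule order_trans[OF card_mono[of "{..<length u}"]]) auto

lemma int_mirk: "int (mirk u t) = int (hamming u t) * (int (length u) - int (hamming u t))"
  using hamming_le_length[of u t] by (simp add: mirk_def of_nat_diff)

lemma concat_nth_uniform:
  assumes "\<forall>t\<in>set ts. length t = n" "i < length ts" "j < n"
  shows "concat ts ! (i * n + j) = ts ! i ! j"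
  using assms
proof (induction ts arbitrary: i)
  case (Cons t ts)
  then show ?case
    by (cases i) (auto simp: nth_append)
qed simp

definition add_mirk :: com where
  "add_mirk = (Set Vd 0 ;; Set Vj 0 ;; Plus Vr Vn Vzero ;; add_hamming ;;
     Minus Ve Vn Vd ;; Plus Vr Vd Vzero ;; add_product)"

text \<open>Comparison costs 28 per position and the product 5 per unit of Hamming distance; that
  distance is at most \<open>n\<close>, whence the 33.\<close>

lemma wp_add_mirk:
  assumes "vars s Vn = int n" "vars s Vone = 1" "vars s Vzero = 0" "vars s Vp = int p"
    "length u = n"
    "\<And>j. j < n \<Longrightarrow> arrs s Str (p + j) = of_bool (t ! j)"
    "\<And>j. j < n \<Longrightarrow> arrs s Col j \<ge> 0"
    "\<And>j. j < n \<Longrightarrow> arrs s Tab (nat (arrs s Col j)) = of_bool (u ! j)"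
    and "\<And>s'. unchanged {Vx, Vy, Vd, Ve, Vp, Vj, Vr, Vacc} {} s s' \<Longrightarrow>
      vars s' Vacc = vars s Vacc + int (mirk u t) \<Longrightarrow>
      vars s' Vp = int (p + n) \<Longrightarrow> clock s' \<le> clock s + 33 * n + 11 \<Longrightarrow> Q s'"
  shows "wp add_mirk Q s"
  unfolding add_mirk_def
proof (simp, rule wp_add_hamming[where n = n and p = p and u = u and t = t], goal_cases)
  case (10 s')
  show ?case
  proof (simp, rule wp_add_product[where r = "hamming u t"], goal_cases)
    case (3 s'')
    show ?case
      using 3 10 assms(1-5) hamming_le_length[of u t]
      by (intro assms(9)) (simp_all add: unchanged_def int_mirk)
  qed (use 10 assms in \<open>simp_all add: unchanged_def\<close>)
qed (use assms in simp_all)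

definition evaluate :: com where
  "evaluate = (Set Vacc 0 ;; Set Vp 0 ;; Plus Vi Vm Vzero ;; While Vi (add_mirk ;; Minus Vi Vi Vone))"

text \<open>\<open>Vp\<close> is not reset between strings: after \<open>q\<close> of them it stands
  at \<open>q * n\<close>, where the next string begins in the concatenation.\<close>

lemma wp_evaluate:
  assumes "vars s Vm = int (length ts)" "vars s Vn = int n" "vars s Vone = 1" "vars s Vzero = 0"
    "length u = n" "\<forall>t\<in>set ts. length t = n"
    "\<And>q. q < length ts * n \<Longrightarrow> arrs s Str q = of_bool (concat ts ! q)"
    "\<And>j. j < n \<Longrightarrow> arrs s Col j \<ge> 0"
    "\<And>j. j < n \<Longrightarrow> arrs s Tab (nat (arrs s Col j)) = of_bool (u ! j)"
    and "\<And>s'. unchanged {Vx, Vy, Vd, Ve, Vp, Vi, Vj, Vr, Vacc} {} s s' \<Longrightarrow>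
      vars s' Vacc = int (\<Sum>i<length ts. mirk u (ts ! i)) \<Longrightarrow>
      clock s' \<le> clock s + length ts * (33 * n + 15) + 6 \<Longrightarrow> Q s'"
  shows "wp evaluate Q s"
proof -
  define I where "I k s' \<longleftrightarrow> (\<exists>q. q + k = length ts \<and>
      unchanged {Vx, Vy, Vd, Ve, Vp, Vi, Vj, Vr, Vacc} {} s s' \<and> vars s' Vi = int k \<and>
      vars s' Vp = int (q * n) \<and> vars s' Vacc = int (\<Sum>i<q. mirk u (ts ! i)) \<and>
      clock s' + k * (33 * n + 15) \<le> clock s + length ts * (33 * n + 15) + 3)" for k s'
  have "wp (add_mirk ;; Minus Vi Vi Vone) (\<lambda>s'. I k (tick 2 s')) (tick 1 s')" "vars s' Vi > 0"
    if I: "I (Suc k) s'" for k s'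
  proof -
    obtain q where q: "q + Suc k = length ts"
      "unchanged {Vx, Vy, Vd, Ve, Vp, Vi, Vj, Vr, Vacc} {} s s'" "vars s' Vi = int (Suc k)"
      "vars s' Vp = int (q * n)" "vars s' Vacc = int (\<Sum>i<q. mirk u (ts ! i))"
      "clock s' + Suc k * (33 * n + 15) \<le> clock s + length ts * (33 * n + 15) + 3"
      using I unfolding I_def by blast
    have "arrs s Str (q * n + j) = of_bool (ts ! q ! j)" if "j < n" for j
    proof -
      have "q * n + j < Suc q * n"
        using that by simp
      also have "\<dots> \<le> length ts * n"
        using q(1) by (intro mult_le_mono1) simp
      finally show ?thesis
        using assms(6,7) that q(1) by (simp add: concat_nth_uniform)
    qed
    then show "wp (add_mirk ;; Minus Vi Vi Vone) (\<lambda>s'. I k (tick 2 s')) (tick 1 s')"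
      unfolding wp_simps(8)
      apply (intro wp_add_mirk[where n = n and p = "q * n" and u = u and t = "ts ! q"])
      using q assms(2-9) apply (simp_all add: unchanged_def)[8]
      subgoal for s''
        using q assms(2-9) unfolding I_def
        by (simp, intro exI[of _ "Suc q"])
           (simp add: unchanged_def distrib_right[of 1 "int q"])
      done
    show "vars s' Vi > 0"
      using q(3) by simp
  qed
  moreover have "\<not> vars s' Vi > 0 \<and> Q (tick 3 s')" if "I 0 s'" for s'
    using that unfolding I_def by (auto intro!: assms(10) simp: unchanged_def)
  moreover have "I (length ts) (s\<lparr>vars := (vars s)(Vacc := 0, Vp := 0, Vi := vars s Vm + vars s Vzero),
      clock := clock s + 3\<rparr>)"
    using assms unfolding I_def by (simp add: unchanged_def)
  ultimately show ?thesis
    unfolding evaluate_def by (simp add: wp_While[where I = I] eval_nat_numeral)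
qed

section \<open>Binary counter\<close>

lemma bit_Suc_carry:
  fixes b :: nat
  assumes "\<forall>t<c. bit b t" "\<not> bit b c"
  shows "bit (Suc b) t \<longleftrightarrow> c \<le> t \<and> (t = c \<or> bit b t)"
  using assms
\<comment> \<open>The carry runs through the trailing ones and stops at the lowest zero bit
  \<open>c\<close>. If \<open>c\<close> is positive then \<open>b\<close> is odd, and halving strips
  one trailing one.\<close>
proof (induction c arbitrary: b t)
  case 0
  then show ?case
    by (cases t) (auto simp: bit_0 bit_Suc)
next
  case (Suc c)
  have "odd b"
    using Suc.prems(1) by (auto simp: bit_0)
  then have div: "Suc b div 2 = Suc (b div 2)"
    by presburger
  have "\<forall>t<c. bit (b div 2) t" "\<not> bit (b div 2) c"
    using Suc.prems by (auto simp flip: bit_Suc)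
  from Suc.IH[OF this] show ?case
    using \<open>odd b\<close> by (cases t) (auto simp: bit_0 bit_Suc div)
qed

lemma not_bit_if_less: "b < 2 ^ M \<Longrightarrow> \<not> bit b M" for b :: nat
  by (simp add: bit_iff_odd)

definition increment :: com where
  "increment = (Set Vj 0 ;; Get Vx Tab Vj ;;
     While Vx (Put Tab Vj Vzero ;; Plus Vj Vj Vone ;; Get Vx Tab Vj) ;; Put Tab Vj Vone)"

lemma wp_increment:
  assumes "vars s Vone = 1" "vars s Vzero = 0"
    "arrs s Tab = (\<lambda>t. of_bool (bit b t))" "b < 2 ^ M"
    and "\<And>s'. unchanged {Vx, Vj} {Tab} s s' \<Longrightarrow> arrs s' Tab = (\<lambda>t. of_bool (bit (Suc b) t)) \<Longrightarrow>
      clock s' \<le> clock s + 16 * M + 16 \<Longrightarrow> Q s'"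
  shows "wp increment Q s"
proof -
  define c where "c = (LEAST t. \<not> bit b t)"
  have c: "\<not> bit b c" "c \<le> M" "\<forall>t<c. bit b t"
    unfolding c_def using not_bit_if_less[OF assms(4)] LeastI[of "\<lambda>t. \<not> bit b t" M]
    by (auto intro: Least_le dest: not_less_Least)
  define I where "I k s' \<longleftrightarrow> (\<exists>q. q + k = c \<and> unchanged {Vx, Vj} {Tab} s s' \<and>
      vars s' Vj = int q \<and> vars s' Vx = of_bool (bit b q) \<and>
      arrs s' Tab = (\<lambda>t. of_bool (q \<le> t \<and> bit b t)) \<and>
      clock s' + 16 * k \<le> clock s + 16 * c + 7)" for k s'
  have "vars s' Vx > 0 \<and> wp (Put Tab Vj Vzero ;; Plus Vj Vj Vone ;; Get Vx Tab Vj)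
      (\<lambda>s'. I k (tick 2 s')) (tick 1 s')" if I: "I (Suc k) s'" for k s'
  proof -
    obtain q where q: "q + Suc k = c" "unchanged {Vx, Vj} {Tab} s s'"
      "vars s' Vj = int q" "vars s' Vx = of_bool (bit b q)"
      "arrs s' Tab = (\<lambda>t. of_bool (q \<le> t \<and> bit b t))"
      "clock s' + 16 * Suc k \<le> clock s + 16 * c + 7"
      using I unfolding I_def by blast
    have "(\<lambda>t. of_bool (q \<le> t \<and> bit b t))(q := 0) = (\<lambda>t. of_bool (Suc q \<le> t \<and> bit b t) :: int)"
      by (auto simp: fun_eq_iff)
    moreover have "nat (1 + int q) = Suc q" "nat (int q + 1) = Suc q"
      by auto
    moreover have "bit b q"
      using c q(1) by simp
    ultimately show ?thesis
      using q assms(1,2) unfolding I_def by (auto simp: unchanged_def intro!: exI[of _ "Suc q"])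
  qed
  moreover have "\<not> vars s' Vx > 0 \<and> wp (Put Tab Vj Vone) Q (tick 3 s')" if "I 0 s'" for s'
  proof -
    have "(\<lambda>t. of_bool (c \<le> t \<and> bit b t))(c := 1) = (\<lambda>t. of_bool (bit (Suc b) t) :: int)"
      by (auto simp: fun_eq_iff bit_Suc_carry[OF c(3,1)])
    then show ?thesis
      using that c assms(1) unfolding I_def by (auto simp: unchanged_def intro!: assms(5))
  qed
  moreover have "I c (s\<lparr>vars := (vars s)(Vj := 0, Vx := arrs s Tab 0), clock := clock s + 7\<rparr>)"
    using assms unfolding I_def by (auto simp: unchanged_def)
  ultimately show ?thesis
    unfolding increment_def by (simp add: wp_While[where I = I] eval_nat_numeral)
qed

section \<open>Column codes and reading the input\<close>

definition code :: "bool list \<Rightarrow> nat" where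
  "code = foldl (\<lambda>c b. 2 * c + of_bool b) 0"

lemma code_Nil [simp]: "code [] = 0"
  by (simp add: code_def)

text \<open>The first string supplies the most significant bit, so a new string only doubles each
  code and adds a bit. This allows the codes to be built while the input is read.\<close>

lemma code_snoc [simp]: "code (bs @ [b]) = 2 * code bs + of_bool b"
  by (simp add: code_def)

lemma code_less: "code bs < 2 ^ length bs"
  by (induction bs rule: rev_induct) auto

text \<open>The parity of a code is the last bit and its half is the code of the rest. Equal length
  matters, since leading zeros do not show in the code.\<close>

lemma code_inject: "length bs = length cs \<Longrightarrow> code bs = code cs \<Longrightarrow> bs = cs"
proof (induction bs arbitrary: cs rule: rev_induct)
  case (snoc b bs)
  then obtain c ds where cs: "cs = ds @ [c]"
    by (cases cs rule: rev_cases) auto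
  have "2 * code bs + of_bool b = 2 * code ds + of_bool c"
    using snoc.prems(2) by (simp add: cs)
  then have "b = c" "code bs = code ds"
    by (cases b; cases c; simp; presburger)+
  then show ?case
    using snoc.IH[of ds] snoc.prems(1) by (simp add: cs)
qed simp

definition read_row :: com where
  "read_row = (Set Vj 0 ;; Plus Vr Vn Vzero ;;
     While Vr (Input Vx ;; Put Str Vp Vx ;; Plus Vp Vp Vone ;;
       Get Vy Col Vj ;; Plus Vy Vy Vy ;; Plus Vy Vy Vx ;; Put Col Vj Vy ;;
       Plus Vj Vj Vone ;; Minus Vr Vr Vone))"

text \<open>The claim on cells below \<open>p\<close> preserves the strings read earlier.\<close>

lemma wp_read_row:
  assumes "vars s Vn = int n" "vars s Vone = 1" "vars s Vzero = 0" "vars s Vp = int p"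
    "ins s = map of_bool t @ vs" "length t = n"
    and "\<And>s'. unchanged {Vj, Vr, Vx, Vp, Vy} {Str, Col} s s' \<Longrightarrow> ins s' = vs \<Longrightarrow>
      vars s' Vp = int (p + n) \<Longrightarrow>
      (\<And>q. q < p \<Longrightarrow> arrs s' Str q = arrs s Str q) \<Longrightarrow>
      (\<And>j. j < n \<Longrightarrow> arrs s' Str (p + j) = of_bool (t ! j)) \<Longrightarrow>
      (\<And>j. j < n \<Longrightarrow> arrs s' Col j = 2 * arrs s Col j + of_bool (t ! j)) \<Longrightarrow>
      clock s' \<le> clock s + 27 * n + 5 \<Longrightarrow> Q s'"
  shows "wp read_row Q s"
proof -
  let ?body = "Input Vx ;; Put Str Vp Vx ;; Plus Vp Vp Vone ;;
       Get Vy Col Vj ;; Plus Vy Vy Vy ;; Plus Vy Vy Vx ;; Put Col Vj Vy ;;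
       Plus Vj Vj Vone ;; Minus Vr Vr Vone"
  define I where "I k s' \<longleftrightarrow> (\<exists>q. q + k = n \<and> unchanged {Vj, Vr, Vx, Vp, Vy} {Str, Col} s s' \<and>
      ins s' = map of_bool (drop q t) @ vs \<and> vars s' Vr = int k \<and> vars s' Vj = int q \<and>
      vars s' Vp = int (p + q) \<and>
      (\<forall>i<p. arrs s' Str i = arrs s Str i) \<and>
      (\<forall>j<q. arrs s' Str (p + j) = of_bool (t ! j)) \<and>
      (\<forall>j<n. arrs s' Col j =
        (if j < q then 2 * arrs s Col j + of_bool (t ! j) else arrs s Col j)) \<and>
      clock s' + 27 * k \<le> clock s + 27 * n + 2)" for k s'
  have "vars s' Vr > 0 \<and> wp ?body (\<lambda>s'. I k (tick 2 s')) (tick 1 s')" if I: "I (Suc k) s'" for k s'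
  proof -
    obtain q where q: "q + Suc k = n" "unchanged {Vj, Vr, Vx, Vp, Vy} {Str, Col} s s'"
      "ins s' = map of_bool (drop q t) @ vs" "vars s' Vr = int (Suc k)" "vars s' Vj = int q"
      "vars s' Vp = int (p + q)" "\<forall>i<p. arrs s' Str i = arrs s Str i"
      "\<forall>j<q. arrs s' Str (p + j) = of_bool (t ! j)"
      "\<forall>j<n. arrs s' Col j =
        (if j < q then 2 * arrs s Col j + of_bool (t ! j) else arrs s Col j)"
      "clock s' + 27 * Suc k \<le> clock s + 27 * n + 2"
      using I unfolding I_def by blast
    have "drop q t = t ! q # drop (Suc q) t"
      using q(1) assms(6) by (intro Cons_nth_drop_Suc[symmetric]) simp
    then show ?thesis
      using q assms(1-4) unfolding I_def
      by (auto simp: unchanged_def nat_int_add less_Suc_eq intro!: exI[of _ "Suc q"])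
  qed
  moreover have "\<not> vars s' Vr > 0 \<and> Q (tick 3 s')" if "I 0 s'" for s'
    using that assms(6) unfolding I_def by (auto intro!: assms(7) simp: unchanged_def)
  moreover have "I n (s\<lparr>vars := (vars s)(Vj := 0, Vr := vars s Vn + vars s Vzero),
      clock := clock s + 2\<rparr>)"
    using assms unfolding I_def by (simp add: unchanged_def)
  ultimately show ?thesis
    unfolding read_row_def by (simp add: wp_While[where I = I] eval_nat_numeral)
qed

text \<open>\<open>Vw\<close> doubles with each string and ends as \<open>2 ^ m\<close> for
  \<open>m\<close> strings, the size of a truth table on column codes.\<close>

definition read_strings :: com where
  "read_strings = (Set Vw 1 ;; Plus Vi Vm Vzero ;;
     While Vi (read_row ;; Plus Vw Vw Vw ;; Minus Vi Vi Vone))"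

abbreviation column :: "bool list list \<Rightarrow> nat \<Rightarrow> bool list" where
  "column ts j \<equiv> map (\<lambda>t. t ! j) ts"

lemma wp_read_strings:
  assumes "vars s Vm = int (length ts)" "vars s Vn = int n" "vars s Vone = 1" "vars s Vzero = 0"
    "vars s Vp = 0" "arrs s Col = (\<lambda>_. 0)"
    "ins s = map of_bool (concat ts)" "\<forall>t\<in>set ts. length t = n"
    and "\<And>s'. unchanged {Vi, Vj, Vr, Vw, Vx, Vp, Vy} {Str, Col} s s' \<Longrightarrow>
      vars s' Vw = 2 ^ length ts \<Longrightarrow>
      (\<And>q. q < length ts * n \<Longrightarrow> arrs s' Str q = of_bool (concat ts ! q)) \<Longrightarrow>
      (\<And>j. j < n \<Longrightarrow> arrs s' Col j = int (code (column ts j))) \<Longrightarrow>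
      clock s' \<le> clock s + length ts * (27 * n + 10) + 5 \<Longrightarrow> Q s'"
  shows "wp read_strings Q s"
proof -
  let ?body = "read_row ;; Plus Vw Vw Vw ;; Minus Vi Vi Vone"
  let ?B = "27 * n + 10"
  define I where "I k s' \<longleftrightarrow> (\<exists>q. q + k = length ts \<and>
      unchanged {Vi, Vj, Vr, Vw, Vx, Vp, Vy} {Str, Col} s s' \<and>
      ins s' = map of_bool (concat (drop q ts)) \<and> vars s' Vi = int k \<and> vars s' Vw = 2 ^ q \<and>
      vars s' Vp = int (q * n) \<and>
      (\<forall>i<q * n. arrs s' Str i = of_bool (concat ts ! i)) \<and>
      (\<forall>j<n. arrs s' Col j = int (code (column (take q ts) j))) \<and>
      clock s' + k * ?B \<le> clock s + length ts * ?B + 2)" for k s'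
  have "vars s' Vi > 0 \<and> wp ?body (\<lambda>s'. I k (tick 2 s')) (tick 1 s')" if I: "I (Suc k) s'" for k s'
  proof -
    obtain q where q: "q + Suc k = length ts"
      "unchanged {Vi, Vj, Vr, Vw, Vx, Vp, Vy} {Str, Col} s s'"
      "ins s' = map of_bool (concat (drop q ts))" "vars s' Vi = int (Suc k)" "vars s' Vw = 2 ^ q"
      "vars s' Vp = int (q * n)"
      "\<forall>i<q * n. arrs s' Str i = of_bool (concat ts ! i)"
      "\<forall>j<n. arrs s' Col j = int (code (column (take q ts) j))"
      "clock s' + Suc k * ?B \<le> clock s + length ts * ?B + 2"
      using I unfolding I_def by blast
    have q': "q < length ts"
      using q(1) by simp
    then have drop: "drop q ts = ts ! q # drop (Suc q) ts"
      by (intro Cons_nth_drop_Suc[symmetric])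
    have "wp read_row (wp (Plus Vw Vw Vw ;; Minus Vi Vi Vone) (\<lambda>s'. I k (tick 2 s'))) (tick 1 s')"
    proof (rule wp_read_row[where n = n and p = "q * n" and t = "ts ! q"
          and vs = "map of_bool (concat (drop (Suc q) ts))"], goal_cases)
      case (7 s'')
      have "arrs s'' Str i = of_bool (concat ts ! i)" if "i < Suc q * n" for i
      proof (cases "i < q * n")
        case True
        then show ?thesis
          using 7(4) q(7) by simp
      next
        case False
        then obtain j where "i = q * n + j"
          using le_Suc_ex[of "q * n" i] by auto
        moreover from this have "j < n"
          using that by simp
        ultimately show ?thesis
          using 7(5)[of j] concat_nth_uniform[OF assms(8) q', of j] by simp
      qed
      moreover have "arrs s'' Col j = int (code (column (take (Suc q) ts) j))" if "j < n" for j
        using 7(6)[OF that] q(8) q' that by (simp add: take_Suc_conv_app_nth)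
      ultimately show ?case
        using 7(1-3,7) q(1,2,4,5,9) assms(3) unfolding I_def
        by (simp, intro exI[of _ "Suc q"])
           (simp add: unchanged_def distrib_right[of 1 "int q"])
    qed (use q q' drop assms in \<open>simp_all add: unchanged_def\<close>)
    then show ?thesis
      using q(4) by simp
  qed
  moreover have "\<not> vars s' Vi > 0 \<and> Q (tick 3 s')" if "I 0 s'" for s'
    using that unfolding I_def by (auto intro!: assms(9) simp: unchanged_def)
  moreover have "I (length ts) (s\<lparr>vars := (vars s)(Vw := 1, Vi := vars s Vm + vars s Vzero),
      clock := clock s + 2\<rparr>)"
    using assms unfolding I_def by (simp add: unchanged_def)
  ultimately show ?thesis
    unfolding read_strings_def by (simp add: wp_While[where I = I] eval_nat_numeral)
qed

section \<open>Exhaustive search over truth tables\<close>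

definition search :: com where
  "search = (Set Vgo 1 ;; While Vgo (evaluate ;; Minus Vx Vacc Vk ;;
     Branch Vx (Set Vx 0) (Set Vres 1) ;; increment ;; Get Vx Tab Vw ;; Minus Vgo Vone Vx))"

definition total_mirk :: "bool list list \<Rightarrow> bool list \<Rightarrow> nat" where
  "total_mirk ts u = (\<Sum>i<length ts. mirk u (ts ! i))"

text \<open>The bits of \<open>b\<close> tabulate a Boolean function on column codes.\<close>

definition candidate :: "bool list list \<Rightarrow> nat \<Rightarrow> nat \<Rightarrow> bool list" where
  "candidate ts n b = map (\<lambda>j. bit b (code (column ts j))) [0..<n]"

text \<open>The counter \<open>b\<close> is both the loop index and the truth table under test. Cell
  \<open>M\<close> lies just beyond the table and becomes 1 exactly when the counter overflows,
  which ends the search.\<close>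

lemma wp_search:
  assumes "vars s Vm = int (length ts)" "vars s Vn = int n" "vars s Vone = 1" "vars s Vzero = 0"
    "vars s Vw = int M" "vars s Vres = 0" "\<forall>t\<in>set ts. length t = n"
    "arrs s Tab = (\<lambda>_. 0)"
    "\<And>q. q < length ts * n \<Longrightarrow> arrs s Str q = of_bool (concat ts ! q)"
    "\<And>j. j < n \<Longrightarrow> arrs s Col j = int (code (column ts j))"
    and "\<And>s'. outs s' = outs s \<Longrightarrow>
      vars s' Vres = of_bool (\<exists>b<2 ^ M. int (total_mirk ts (candidate ts n b)) \<le> vars s Vk) \<Longrightarrow>
      clock s' \<le> clock s + 2 ^ M * (length ts * (33 * n + 15) + 16 * M + 37) + 4 \<Longrightarrow> Q s'"
  shows "wp search Q s"
proof -
  let ?body = "evaluate ;; Minus Vx Vacc Vk ;;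
     Branch Vx (Set Vx 0) (Set Vres 1) ;; increment ;; Get Vx Tab Vw ;; Minus Vgo Vone Vx"
  let ?X = "{Vx, Vy, Vd, Ve, Vp, Vi, Vj, Vr, Vacc, Vres, Vgo}"
  let ?B = "length ts * (33 * n + 15) + 16 * M + 37"
  let ?good = "\<lambda>b. int (total_mirk ts (candidate ts n b)) \<le> vars s Vk"
  define I where "I k s' \<longleftrightarrow> (\<exists>b. b + k = 2 ^ M \<and> unchanged ?X {Tab} s s' \<and>
      arrs s' Tab = (\<lambda>t. of_bool (bit b t)) \<and> vars s' Vgo = of_bool (k > 0) \<and>
      vars s' Vres = of_bool (\<exists>b'<b. ?good b') \<and>
      clock s' + k * ?B \<le> clock s + 2 ^ M * ?B + 1)" for k s'
  have "vars s' Vgo > 0 \<and> wp ?body (\<lambda>s'. I k (tick 2 s')) (tick 1 s')" if I: "I (Suc k) s'" for k s'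
  proof -
    obtain b where b: "b + Suc k = 2 ^ M" "unchanged ?X {Tab} s s'"
      "arrs s' Tab = (\<lambda>t. of_bool (bit b t))" "vars s' Vgo = 1"
      "vars s' Vres = of_bool (\<exists>b'<b. ?good b')"
      "clock s' + Suc k * ?B \<le> clock s + 2 ^ M * ?B + 1"
      using I unfolding I_def by auto
    have b_less: "b < 2 ^ M"
      using b(1) by linarith
    \<comment> \<open>Among the counter values reached, only \<open>2 ^ M\<close> has bit
      \<open>M\<close> set, so \<open>Vgo\<close> becomes 0 right after the last table.\<close>
    have bit_M: "bit (Suc b) M \<longleftrightarrow> k = 0"
    proof (cases "k = 0")
      case True
      then have "Suc b = 2 ^ M"
        using b(1) by simp
      then show ?thesis
        using True by (simp add: bit_exp_iff)
    next
      case False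
      then have "Suc b < 2 ^ M"
        using b(1) by linarith
      then show ?thesis
        using False not_bit_if_less by blast
    qed
    have fin: "I k s4"
      if "unchanged ?X {Tab} s s4" "arrs s4 Tab = (\<lambda>t. of_bool (bit (Suc b) t))"
        "vars s4 Vgo = 1 - of_bool (bit (Suc b) M)"
        "vars s4 Vres = of_bool ((\<exists>b'<b. ?good b') \<or> ?good b)"
        "clock s4 \<le> clock s' + ?B" for s4
      using that b(1,6) bit_M unfolding I_def
      by (intro exI[of _ "Suc b"]) (auto simp: unchanged_def less_Suc_eq)
    have "wp evaluate (wp (Minus Vx Vacc Vk ;;
     Branch Vx (Set Vx 0) (Set Vres 1) ;; increment ;; Get Vx Tab Vw ;; Minus Vgo Vone Vx)
       (\<lambda>s'. I k (tick 2 s'))) (tick 1 s')"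
    proof (rule wp_evaluate[where n = n and ts = ts and u = "candidate ts n b"], goal_cases)
      case (10 s2)
      have acc: "vars s2 Vacc = int (total_mirk ts (candidate ts n b))"
        using 10(2) by (simp add: total_mirk_def)
      \<comment> \<open>An arbitrary \<open>s3\<close> serves both branches; 5 is the cost of the
        subtraction and the slower branch.\<close>
      have inc: "wp increment (wp (Get Vx Tab Vw ;; Minus Vgo Vone Vx) (\<lambda>s'. I k (tick 2 s'))) s3"
        if "unchanged {Vx, Vres} {} s2 s3"
          "vars s3 Vres = of_bool ((\<exists>b'<b. ?good b') \<or> ?good b)" "clock s3 \<le> clock s2 + 5" for s3
      proof (rule wp_increment[where b = b and M = M], goal_cases)
        case (5 s4)
        have "vars s4 Vw = int M" "vars s4 Vone = 1"
          using 5(1) that(1) 10(1) b(2) assms(3,5) by (simp_all add: unchanged_def)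
        then show ?case
          using 5 that 10(1,3) b(2) unfolding wp_simps
          by (intro conjI fin) (simp_all add: unchanged_def)
      qed (use that 10 b b_less assms in \<open>simp_all add: unchanged_def\<close>)
      have "vars s2 Vk = vars s Vk" "vars s2 Vres = of_bool (\<exists>b'<b. ?good b')"
        using 10(1) b(2,5) by (simp_all add: unchanged_def)
      then show ?case
        using acc by (simp only: wp_simps split: if_split, intro conjI impI inc)
          (simp_all add: unchanged_def)
    qed (use b assms in \<open>simp_all add: unchanged_def candidate_def\<close>)
    then show ?thesis
      using b(4) by simp
  qed
  moreover have "\<not> vars s' Vgo > 0 \<and> Q (tick 3 s')" if "I 0 s'" for s'
    using that unfolding I_def by (auto intro!: assms(11) simp: unchanged_def)
  moreover have "I (2 ^ M) (s\<lparr>vars := (vars s)(Vgo := 1), clock := Suc (clock s)\<rparr>)"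
    using assms unfolding I_def by (simp add: unchanged_def)
  ultimately show ?thesis
    unfolding search_def by (simp add: wp_While[where I = I])
qed

definition mdm_com :: com where
  "mdm_com = (Input Vm ;; Input Vn ;; Input Vk ;; Set Vone 1 ;; read_strings ;; search ;; Output Vres)"

text \<open>Columns have \<open>2 ^ m\<close> possible codes, so the search runs with
  \<open>M = 2 ^ m\<close>. All memory starts at 0, which is the initial value that
  \<open>Vzero\<close>, \<open>Vres\<close>, \<open>Col\<close> and \<open>Tab\<close>
  require.\<close>

lemma wp_mdm_com:
  assumes "\<forall>t\<in>set ts. length t = n" "m = length ts"
    and ans: "ans = of_bool (\<exists>b<2 ^ 2 ^ m. int (total_mirk ts (candidate ts n b)) \<le> k)"
    and T: "T = 2 ^ 2 ^ m * (m * (33 * n + 15) + 16 * 2 ^ m + 37) + m * (27 * n + 10) + 14"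
  shows "wp mdm_com (\<lambda>s. outs s = [ans] \<and> clock s \<le> T)
    \<lparr>vars = (\<lambda>_. 0), arrs = (\<lambda>_ _. 0), ins = mdm_encode (n, ts, k), outs = [], clock = 0\<rparr>"
  unfolding mdm_com_def
proof (simp add: mdm_encode_def, rule wp_read_strings[where ts = ts and n = n], goal_cases)
  case (9 s)
  have "wp search (wp (Output Vres) (\<lambda>s. outs s = [ans] \<and> clock s \<le> T)) s"
  proof (rule wp_search[where ts = ts and n = n and M = "2 ^ m"], goal_cases)
    case (11 s')
    have "vars s' Vres = ans"
      using 9(1) 11(2) ans by (simp add: unchanged_def)
    moreover have "clock s' + 1 \<le> T"
      using 9(5) 11(3) assms(2) T by simp
    ultimately show ?case
      using 9(1) 11(1) by (simp add: unchanged_def)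
  qed (use 9 assms(1,2) in \<open>simp_all add: unchanged_def\<close>)
  then show ?case
    by simp
qed (use assms(1) in \<open>simp_all add: map_concat\<close>)

section \<open>Optimal strings are constant on equal columns\<close>

lemma hamming_flip:
  assumes "j < length u"
  shows "int (hamming (u[j := \<not> u ! j]) t) = int (hamming u t) + (if u ! j = t ! j then 1 else - 1)"
proof -
  have "(\<Sum>i\<in>{..<length u} - {j}. of_bool (u[j := \<not> u ! j] ! i \<noteq> t ! i)) =
      (\<Sum>i\<in>{..<length u} - {j}. of_bool (u ! i \<noteq> t ! i) :: int)"
    by (rule sum.cong) auto
  then show ?thesis
    using assms unfolding hamming_eq_sum
    by (simp add: sum.remove[of "{..<length u}" j] del: sum_of_bool_eq)
qed

text \<open>Strict concavity of \<open>h \<mapsto> h (n - h)\<close>: the two flips move the Hamming distance to \<open>t\<close> by one in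
  opposite directions.\<close>

lemma mirk_exchange:
  assumes "i < length u" "j < length u" "u ! i" "\<not> u ! j" "t ! i = t ! j"
  shows "int (mirk (u[i := False]) t) + int (mirk (u[j := True]) t) = 2 * int (mirk u t) - 2"
proof -
  \<comment> \<open>With \<open>h\<close> the distance, \<open>(h + e)(n - h - e) + (h - e)(n - h +
    e) = 2 h (n - h) - 2 e^2\<close>, so only \<open>e * e = 1\<close> matters and not the sign of
    \<open>e\<close>.\<close>
  define e :: int where "e = (if t ! i then 1 else - 1)"
  have "e * e = 1"
    by (simp add: e_def)
  moreover have flips: "int (hamming (u[i := False]) t) = int (hamming u t) + e"
    "int (hamming (u[j := True]) t) = int (hamming u t) - e"
    using hamming_flip[of i u t] hamming_flip[of j u t] assms by (auto simp: e_def)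
  ultimately show ?thesis
    unfolding int_mirk flips by (simp add: algebra_simps)
qed

text \<open>Summed over all strings, the two flips lose 2 per string against twice the optimum. With
  at least one string, one of the flips would be strictly better than \<open>u\<close>.\<close>

lemma optimal_constant_on_columns:
  assumes "ts \<noteq> []" "length u = n" "\<And>v. length v = n \<Longrightarrow> total_mirk ts u \<le> total_mirk ts v"
    and "i < n" "j < n" "column ts i = column ts j" "u ! i"
  shows "u ! j"
proof (rule ccontr)
  assume "\<not> u ! j"
  have "int (mirk (u[i := False]) (ts ! l)) + int (mirk (u[j := True]) (ts ! l)) =
      2 * int (mirk u (ts ! l)) - 2" if "l < length ts" for l
    using that assms \<open>\<not> u ! j\<close> by (intro mirk_exchange) (auto simp: map_eq_conv)
  then have "int (total_mirk ts (u[i := False])) + int (total_mirk ts (u[j := True])) =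
      (\<Sum>l<length ts. 2 * int (mirk u (ts ! l)) - 2)"
    by (simp add: total_mirk_def flip: sum.distrib)
  also have "\<dots> = 2 * int (total_mirk ts u) - 2 * int (length ts)"
    by (simp add: total_mirk_def sum_subtractf sum_distrib_left)
  finally show False
    using assms(1) assms(3)[of "u[i := False]"] assms(3)[of "u[j := True]"] assms(2)
    by (cases ts) auto
qed

text \<open>The values of \<open>P\<close> serve as binary digits, least significant first. This
  turns a Boolean function on codes into a counter value.\<close>

lemma ex_bits: "\<exists>b::nat. b < 2 ^ M \<and> (\<forall>c<M. bit b c \<longleftrightarrow> P c)"
proof (intro exI conjI allI impI)
  let ?b = "horner_sum of_bool 2 (map P [0..<M]) :: nat"
  show "?b < 2 ^ M"
    using horner_sum_of_bool_2_less[of "map P [0..<M]"] by (simp flip: of_nat_less_iff)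
  show "bit ?b c \<longleftrightarrow> P c" if "c < M" for c
    using that by (simp add: bit_horner_sum_bit_iff)
qed

lemma length_candidate [simp]: "length (candidate ts n b) = n"
  by (simp add: candidate_def)

text \<open>Candidates have length \<open>n\<close>, which gives one direction. Conversely an
  optimal string costs no more than the given one and is itself a candidate.\<close>

theorem mdm_yes_iff_candidate:
  "mdm_yes (n, ts, k) \<longleftrightarrow> (\<exists>b<2 ^ 2 ^ length ts. int (total_mirk ts (candidate ts n b)) \<le> k)"
proof
  assume "\<exists>b<2 ^ 2 ^ length ts. int (total_mirk ts (candidate ts n b)) \<le> k"
  then obtain b where "int (total_mirk ts (candidate ts n b)) \<le> k"
    by blast
  then show "mdm_yes (n, ts, k)"
    unfolding mdm_yes_def total_mirk_def by (auto intro!: exI[of _ "candidate ts n b"])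
next
  assume "mdm_yes (n, ts, k)"
  then obtain s where s: "length s = n" "int (total_mirk ts s) \<le> k"
    unfolding mdm_yes_def total_mirk_def by auto
  show "\<exists>b<2 ^ 2 ^ length ts. int (total_mirk ts (candidate ts n b)) \<le> k"
  proof (cases "ts = []")
    \<comment> \<open>Without strings the objective is 0 everywhere, so any candidate works; the
      exchange argument would not be strict here.\<close>
    case True
    then show ?thesis
      using s(2) by (intro exI[of _ 0]) (simp add: total_mirk_def)
  next
    case False
    obtain u where u: "length u = n" "\<And>v. length v = n \<Longrightarrow> total_mirk ts u \<le> total_mirk ts v"
      using ex_has_least_nat[of "\<lambda>v. length v = n" s "total_mirk ts"] s(1) by blast
    obtain b :: nat where b: "b < 2 ^ 2 ^ length ts" "\<And>c. c < 2 ^ length ts \<Longrightarrow>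
        bit b c \<longleftrightarrow> (\<exists>i<n. u ! i \<and> code (column ts i) = c)"
      using ex_bits[of "2 ^ length ts" "\<lambda>c. \<exists>i<n. u ! i \<and> code (column ts i) = c"] by blast
    have "bit b (code (column ts j)) \<longleftrightarrow> u ! j" if "j < n" for j
    proof -
      have "code (column ts j) < 2 ^ length ts"
        using code_less[of "column ts j"] by simp
      \<comment> \<open>Equal codes come from equal columns, on which the optimal \<open>u\<close>
        is constant. So the existential defining the table collapses to
        \<open>u ! j\<close>.\<close>
      moreover have "u ! j" if "i < n" "u ! i" "code (column ts i) = code (column ts j)" for i
        using optimal_constant_on_columns[OF False u, of i j] code_inject[OF _ that(3)] that \<open>j < n\<close>
        by simp
      ultimately show ?thesis
        using b(2) that by blast
    qed
    then have "candidate ts n b = u"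
      using u(1) by (intro nth_equalityI) (simp_all add: candidate_def)
    then have "int (total_mirk ts (candidate ts n b)) \<le> k"
      using u(2)[OF s(1)] s(2) by simp
    then show ?thesis
      using b(1) by blast
  qed
qed

section \<open>Running time\<close>

text \<open>For \<open>n\<close> at least 1, each summand is absorbed into a multiple of
  \<open>M * n\<close>: \<open>33 + 15 + 16 + 37 = 101\<close> and
  \<open>27 + 10 + 14 = 51\<close>.\<close>

lemma time_bound:
  fixes m n :: nat
  assumes "n \<ge> 1"
  shows "2 ^ 2 ^ m * (m * (33 * n + 15) + 16 * 2 ^ m + 37) + m * (27 * n + 10) + 14 \<le>
    2 ^ (2 ^ m + m + 8) * n ^ 2"
proof -
  define M :: nat where "M = 2 ^ m"
  have M: "m \<le> M" "1 \<le> M"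
    using less_exp[of m] by (auto simp: M_def)
  have "1 \<le> M * n" "M \<le> M * n" "m \<le> M * n" "m * n \<le> M * n"
    using M assms by (auto intro: order_trans[of _ M])
  moreover have "m * (33 * n + 15) = 33 * (m * n) + 15 * m" "m * (27 * n + 10) = 27 * (m * n) + 10 * m"
    by (simp_all add: algebra_simps)
  ultimately have *: "m * (33 * n + 15) + 16 * M + 37 \<le> 101 * (M * n)" "m * (27 * n + 10) + 14 \<le> 51 * (M * n)"
    by linarith+
  have "51 * (M * n) \<le> 2 ^ M * (51 * (M * n))"
    by simp
  then have "m * (27 * n + 10) + 14 \<le> 2 ^ M * (51 * (M * n))"
    using *(2) by linarith
  then have "2 ^ M * (m * (33 * n + 15) + 16 * M + 37) + m * (27 * n + 10) + 14 \<le>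
      2 ^ M * (101 * (M * n)) + 2 ^ M * (51 * (M * n))"
    using add_mono[OF mult_le_mono2[OF *(1)]] by (simp only: add.assoc)
  also have "\<dots> = 152 * (2 ^ M * M * n)"
    by (simp add: algebra_simps)
  \<comment> \<open>Here \<open>101 + 51 = 152\<close> is rounded up to \<open>2 ^ 8\<close>, and
    the linear factor \<open>n\<close> is weakened to \<open>n ^ 2\<close>.\<close>
  also have "\<dots> \<le> 2 ^ 8 * (2 ^ M * M * n ^ 2)"
    using assms by (intro mult_le_mono order_refl) (auto simp: power2_eq_square)
  also have "\<dots> = 2 ^ (M + m + 8) * n ^ 2"
    by (simp add: M_def power_add algebra_simps)
  finally show ?thesis
    unfolding M_def by simp
qed

text \<open>The exponent is of order \<open>2 ^ m\<close>, well below the bound. The factor 10 is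
  \<open>1 + 1 + 8\<close>, one share for each summand, and \<open>m = 0\<close> is excluded because
  the right-hand side vanishes there.\<close>

lemma exponent_bigo: "(\<lambda>m. real (2 ^ m + m + 8)) \<in> O(\<lambda>m. real m ^ 2 * 2 ^ (m ^ 2))"
proof (rule bigoI[of _ 10], rule eventually_sequentiallyI[of 1])
  fix m :: nat
  assume m: "1 \<le> m"
  then have sq: "m \<le> m ^ 2" "1 \<le> m ^ 2"
    by (auto simp: power2_eq_square)
  have "(2::nat) ^ m \<le> 2 ^ (m ^ 2)"
    using sq by (intro power_increasing) auto
  also have "\<dots> \<le> m ^ 2 * 2 ^ (m ^ 2)"
    using sq by simp
  finally have a: "2 ^ m \<le> m ^ 2 * 2 ^ (m ^ 2)" .
  moreover have "m \<le> 2 ^ m" "1 \<le> (2::nat) ^ m"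
    using less_exp[of m] by auto
  ultimately have "2 ^ m + m + 8 \<le> 10 * (m ^ 2 * 2 ^ (m ^ 2))"
    by linarith
  then have "real (2 ^ m + m + 8) \<le> real (10 * (m ^ 2 * 2 ^ (m ^ 2)))"
    by (rule of_nat_mono)
  then show "norm (real (2 ^ m + m + 8)) \<le> 10 * norm (real m ^ 2 * 2 ^ (m ^ 2))"
    by simp
qed

theorem theorem2:
  "\<exists>(P :: program) (g :: nat \<Rightarrow> real).
     g \<in> O(\<lambda>m. real m ^ 2 * 2 ^ (m ^ 2)) \<and>
     decides_in_time P mdm_instances mdm_encode mdm_yes
       (\<lambda>(n, ss, k). 2 powr g (length ss) * real n ^ 2)"
proof (intro exI conjI)
  show "(\<lambda>m. real (2 ^ m + m + 8)) \<in> O(\<lambda>m. real m ^ 2 * 2 ^ (m ^ 2))"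
    by (rule exponent_bigo)
  show "decides_in_time (compile 0 mdm_com) mdm_instances mdm_encode mdm_yes
     (\<lambda>(n, ss, k). 2 powr real (2 ^ length ss + length ss + 8) * real n ^ 2)"
    unfolding decides_in_time_def
  proof
    fix x
    assume "x \<in> mdm_instances"
    then obtain n ts k where x: "x = (n, ts, k)" and n: "n \<ge> 1" and ts: "\<forall>t\<in>set ts. length t = n"
      by (auto simp: mdm_instances_def)
    \<comment> \<open>The search reports whether a cheap candidate exists, which
      \<open>mdm_yes_iff_candidate\<close> identifies with \<open>mdm_yes\<close>.\<close>
    obtain t where t: "computes_in (compile 0 mdm_com) (mdm_encode x) t [of_bool (mdm_yes x)]"
      and "t \<le> 2 ^ 2 ^ length ts * (length ts * (33 * n + 15) + 16 * 2 ^ length ts + 37) +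
        length ts * (27 * n + 10) + 14"
      using wp_computes_in[OF wp_mdm_com[OF ts refl refl refl]] unfolding x mdm_yes_iff_candidate
      by blast
    then have "t \<le> 2 ^ (2 ^ length ts + length ts + 8) * n ^ 2"
      using time_bound[OF n] order_trans by blast
    then have "real t \<le> real (2 ^ (2 ^ length ts + length ts + 8) * n ^ 2)"
      by (rule of_nat_mono)
    also have "\<dots> = 2 powr real (2 ^ length ts + length ts + 8) * real n ^ 2"
      by (subst powr_realpow) simp_all
    finally show "\<exists>t. computes_in (compile 0 mdm_com) (mdm_encode x) t [if mdm_yes x then 1 else 0] \<and>
        real t \<le> (case x of (n, ss, k) \<Rightarrow> 2 powr real (2 ^ length ss + length ss + 8) * real n ^ 2)"
      using t x by (auto simp: of_bool_def)
  qed
qed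

end
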